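(* Let $r\in\mathbb N$, let $w_1,\dots,w_r$ be positive real numbers, let $q\in\mathbb C$ with $0<|q|<1$, and let $\chi$ be a Dirichlet character with conductor $f\in\mathbb N$, where $f\equiv 1\pmod 2$. For every $x\in\mathbb C$ with $\Re(x)>0$ and every integer $n\ge 0$, $$l_q^{(r)}(-n,x;\chi\mid w_1,\dots,w_r)=E_{n,\chi,q}^{(r)}(x\mid w_1,\dots,w_r).$$
   Context: Fix a branch of $\log q$ and put $q^{a}=\exp(a\log q)$ for real $a$. The generalized Barnes' type $q$-Euler polynomials of order $r$ attached to $\chi$, $E_{n,\chi,q}^{(r)}(x\mid w_1,\dots,w_r)$, are defined by the Taylor expansion around $t=0$ $$e^{xt}\prod_{j=1}^r\left(\frac{2\sum_{b=0}^{f-1}\chi(b)\,q^{w_jb}(-1)^{b}e^{w_jbt}}{q^{w_jf}e^{w_jft}+1}\right)=\sum_{n=0}^{\infty}E_{n,\chi,q}^{(r)}(x\mid w_1,\dots,w_r)\frac{t^n}{n!}.$$ For $s,x\in\mathbb C$ with $\Re(x)>0$, the Dirichlet's type Euler $q$-$l$-function of order $r$ is $$l_q^{(r)}(s,x;\chi\mid w_1,\dots,w_r)=2^r\sum_{m_1,\dots,m_r=0}^{\infty}\frac{\left(\prod_{j=1}^r\chi(m_j)\right)(-1)^{m_1+\cdots+m_r}\,q^{m_1w_1+\cdots+m_rw_r}}{(x+w_1m_1+\cdots+w_rm_r)^s},$$ where the sum is over all $r$-tuples of nonnegative integers and complex powers $z^s$ with $\Re(z)>0$ are taken with the principal branch of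 the logarithm. *)

theory Defs
  imports "HOL-Complex_Analysis.Complex_Analysis" "HOL-Real_Asymp.Real_Asymp"
begin

definition dirichlet_character :: "nat \<Rightarrow> (int \<Rightarrow> complex) \<Rightarrow> bool" where
  "dirichlet_character N chi \<longleftrightarrow>
     N > 0 \<and> chi 1 = 1 \<and>
     (\<forall>a b. chi (a * b) = chi a * chi b) \<and>
     (\<forall>a. chi (a + int N) = chi a) \<and>
     (\<forall>a. chi a = 0 \<longleftrightarrow> \<not> coprime a (int N))"

(* The least divisor d of N such that chi, a character modulo N, is induced by a character modulo d. *)
definition dirichlet_conductor :: "nat \<Rightarrow> (int \<Rightarrow> complex) \<Rightarrow> nat" where
  "dirichlet_conductor N chi =
     (LEAST d. d dvd N \<and>
        (\<exists>\<psi>. dirichlet_character d \<psi> \<and> (\<forall>a. coprime a (int N) \<longrightarrow> chi a = \<psi> a)))"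

(* "A Dirichlet character with conductor f" is regarded as a function of period f, i.e. as a
   primitive character modulo f. For f = 1 this is the constant 1, also at 0. *)
definition dirichlet_character_of_conductor :: "nat \<Rightarrow> (int \<Rightarrow> complex) \<Rightarrow> bool" where
  "dirichlet_character_of_conductor f chi \<longleftrightarrow>
     dirichlet_character f chi \<and> dirichlet_conductor f chi = f"

(* Throughout, L is the chosen value of log q, so that exp L = q, and q ^ a = qpow L a. *)
definition qpow :: "complex \<Rightarrow> real \<Rightarrow> complex" where
  "qpow L a = exp (of_real a * L)"

definition barnes_euler_gf ::
  "complex \<Rightarrow> nat \<Rightarrow> (int \<Rightarrow> complex) \<Rightarrow> nat \<Rightarrow> (nat \<Rightarrow> real) \<Rightarrow> complex \<Rightarrow> complex \<Rightarrow> complex" where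
  "barnes_euler_gf L f chi r w x t =
     exp (x * t) *
     (\<Prod>j\<in>{1..r}.
        (2 * (\<Sum>b<f. chi (int b) * qpow L (w j * real b) * (-1) ^ b
                      * exp (of_real (w j * real b) * t)))
        / (qpow L (w j * real f) * exp (of_real (w j * real f) * t) + 1))"

definition barnes_euler ::
  "complex \<Rightarrow> nat \<Rightarrow> (int \<Rightarrow> complex) \<Rightarrow> nat \<Rightarrow> (nat \<Rightarrow> real) \<Rightarrow> nat \<Rightarrow> complex \<Rightarrow> complex" where
  "barnes_euler L f chi r w n x =
     (THE E. barnes_euler_gf L f chi r w x has_fps_expansion Abs_fps (\<lambda>k. E k / fact k)) n"

definition euler_ql_term ::
  "complex \<Rightarrow> (int \<Rightarrow> complex) \<Rightarrow> nat \<Rightarrow> (nat \<Rightarrow> real) \<Rightarrow> complex \<Rightarrow> complex \<Rightarrow> (nat \<Rightarrow> nat) \<Rightarrow> complex" where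
  "euler_ql_term L chi r w s x m =
     (\<Prod>j\<in>{1..r}. chi (int (m j))) * (-1) ^ (\<Sum>j\<in>{1..r}. m j)
       * qpow L (\<Sum>j\<in>{1..r}. real (m j) * w j)
       / (x + of_real (\<Sum>j\<in>{1..r}. w j * real (m j))) powr s"

definition euler_ql ::
  "complex \<Rightarrow> (int \<Rightarrow> complex) \<Rightarrow> nat \<Rightarrow> (nat \<Rightarrow> real) \<Rightarrow> complex \<Rightarrow> complex \<Rightarrow> complex" where
  "euler_ql L chi r w s x =
     2 ^ r * (\<Sum>\<^sub>\<infinity>m\<in>(\<Pi>\<^sub>E j\<in>{1..r}. (UNIV :: nat set)). euler_ql_term L chi r w s x m)"

(* barnes_euler_has_fps_expansion and euler_ql_term_abs_summable show that neither THE nor the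
   infinite sum falls back to a default value. *)

lemma barnes_euler_has_fps_expansion:
  assumes q: "norm (exp L) < 1" and w: "\<And>j. j \<in> {1..r} \<Longrightarrow> w j > 0" and f: "f > 0"
  shows "barnes_euler_gf L f chi r w x has_fps_expansion
           Abs_fps (\<lambda>n. barnes_euler L f chi r w n x / fact n)"
proof -
  let ?g = "barnes_euler_gf L f chi r w x"
  have nz: "qpow L (w j * real f) + 1 \<noteq> 0" if "j \<in> {1..r}" for j
  proof
    assume "qpow L (w j * real f) + 1 = 0"
    then have "norm (qpow L (w j * real f)) = 1"
      by (metis add_eq_0_iff norm_minus_cancel norm_one)
    moreover have "Re L < 0" using q by simp
    moreover have "w j * real f > 0" using w[OF that] f by simp
    ultimately show False by (auto simp: qpow_def)
  qed
  have "?g analytic_on {0}"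
    unfolding barnes_euler_gf_def by (intro analytic_intros) (use nz in auto)
  then have "?g has_fps_expansion fps_expansion ?g 0"
    by (rule analytic_at_imp_has_fps_expansion_0)
  moreover define E where "E = (\<lambda>n. fps_nth (fps_expansion ?g 0) n * fact n)"
  have "Abs_fps (\<lambda>k. E k / fact k) = fps_expansion ?g 0"
    by (auto simp: E_def fps_eq_iff)
  ultimately have E: "?g has_fps_expansion Abs_fps (\<lambda>k. E k / fact k)" by simp
  have "E' = E" if "?g has_fps_expansion Abs_fps (\<lambda>k. E' k / fact k)" for E'
  proof
    fix n
    have "Abs_fps (\<lambda>k. E' k / fact k) = Abs_fps (\<lambda>k. E k / fact k)"
      using that E by (metis fps_expansion_unique_complex)
    then show "E' n = E n" by (simp add: fps_eq_iff)
  qed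
  then have "(THE E. ?g has_fps_expansion Abs_fps (\<lambda>k. E k / fact k)) = E"
    using E by blast
  then show ?thesis using E by (simp add: barnes_euler_def)
qed

lemma dirichlet_character_bounded:
  assumes "dirichlet_character N chi"
  obtains B where "B > 0" "\<And>a. norm (chi a) \<le> B"
proof -
  have N: "N > 0" and per: "\<And>a. chi (a + int N) = chi a"
    using assms by (auto simp: dirichlet_character_def)
  have nat_per: "chi (a + int N * int k) = chi a" for a k
  proof (induction k)
    case (Suc k)
    then show ?case using per[of "a + int N * int k"] by (simp add: algebra_simps)
  qed simp
  have int_per: "chi (a + int N * k) = chi a" for a k
  proof (cases "k \<ge> 0")
    case True
    then show ?thesis using nat_per[of a "nat k"] by simp
  next
    case False
    then show ?thesis using nat_per[of "a + int N * k" "nat (- k)"] by simp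
  qed
  have "chi a = chi (a mod int N)" for a
    using int_per[of "a mod int N" "a div int N"] by simp
  then have le: "norm (chi a) \<le> (\<Sum>b\<in>{0..<int N}. norm (chi b))" for a
    using member_le_sum[of "a mod int N" "{0..<int N}" "\<lambda>b. norm (chi b)"] N by simp
  have "norm (chi 1) = 1" using assms by (simp add: dirichlet_character_def)
  with le[of 1] have "(\<Sum>b\<in>{0..<int N}. norm (chi b)) > 0" by simp
  with le show ?thesis using that by blast
qed

lemma powr_growth_bound:
  assumes x: "Re x > 0" and d: "d > 0"
  obtains C where "C > 0" "\<And>S. S \<ge> 0 \<Longrightarrow> norm (1 / (x + of_real S) powr s) \<le> C * exp (d * S)"
proof -
  define h where "h = (\<lambda>S::real. norm (1 / (x + of_real S) powr s) * exp (- d * S))"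
  define p where "p = - Re s"
  define a where "a = norm x"
  have a: "a > 0" using x by (auto simp: a_def)
  have hbound: "h S \<le> exp (pi * \<bar>Im s\<bar>) *
      ((Re x) powr p * 1 + (a + S) powr p * exp (- d * S))" if S: "S \<ge> 0" for S
  proof -
    let ?z = "x + of_real S"
    have z: "?z \<noteq> 0" using x S by (auto simp: complex_eq_iff)
    have eq: "norm (1 / ?z powr s) = norm ?z powr p * exp (Im s * Im (Ln ?z))"
      using z by (simp add: norm_divide powr_def p_def exp_diff exp_add exp_minus field_simps)
    have "Im s * Im (Ln ?z) \<le> \<bar>Im s\<bar> * \<bar>Im (Ln ?z)\<bar>"
      by (metis abs_ge_self abs_mult)
    also have "\<dots> \<le> \<bar>Im s\<bar> * pi"
      using mpi_less_Im_Ln[OF z] Im_Ln_le_pi[OF z] by (intro mult_left_mono) auto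
    finally have e: "exp (Im s * Im (Ln ?z)) \<le> exp (pi * \<bar>Im s\<bar>)" by (simp add: mult.commute)
    have lo: "Re x \<le> norm ?z"
      using complex_Re_le_cmod[of ?z] S by simp
    have hi: "norm ?z \<le> a + S"
      using norm_triangle_ineq[of x "of_real S"] S by (simp add: a_def)
    have "norm ?z powr p * exp (- d * S)
            \<le> Re x powr p * 1 + (a + S) powr p * exp (- d * S)"
    proof (cases "p \<ge> 0")
      case True
      have "norm ?z powr p \<le> (a + S) powr p" using hi True by (intro powr_mono2) auto
      then have "norm ?z powr p * exp (- d * S) \<le> (a + S) powr p * exp (- d * S)" by simp
      moreover have "Re x powr p \<ge> 0" by simp
      ultimately show ?thesis by linarith
    next
      case False
      have "norm ?z powr p \<le> Re x powr p" using lo False x by (intro powr_mono2') auto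
      then have "norm ?z powr p * exp (- d * S) \<le> Re x powr p * 1"
        using d S by (intro mult_mono) auto
      moreover have "(a + S) powr p * exp (- d * S) \<ge> 0" by simp
      ultimately show ?thesis by linarith
    qed
    then have "exp (Im s * Im (Ln ?z)) * (norm ?z powr p * exp (- d * S))
         \<le> exp (pi * \<bar>Im s\<bar>) * (Re x powr p * 1 + (a + S) powr p * exp (- d * S))"
      using e by (intro mult_mono) auto
    then show ?thesis by (simp add: h_def eq mult_ac)
  qed
  have "\<exists>M. \<forall>S\<ge>0. (a + S) powr p * exp (- d * S) \<le> M"
  proof -
    define g where "g = (\<lambda>S::real. (a + S) powr p * exp (- d * S))"
    have "(g \<longlongrightarrow> 0) at_top"
      unfolding g_def using d a by real_asymp
    then have "eventually (\<lambda>S. g S < 1) at_top"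
      by (rule order_tendstoD) simp
    then obtain T where T: "\<And>S. S \<ge> T \<Longrightarrow> g S < 1" by (auto simp: eventually_at_top_linorder)
    have "continuous_on {0..T} g"
      unfolding g_def using a by (intro continuous_intros) auto
    then have "bounded (g ` {0..T})"
      by (intro compact_imp_bounded compact_continuous_image) auto
    then obtain M where M: "\<And>S. S \<in> {0..T} \<Longrightarrow> norm (g S) \<le> M"
      by (unfold bounded_iff) blast
    have "g S \<le> max M 1" if "S \<ge> 0" for S
      using T[of S] M[of S] that by (cases "S \<le> T") auto
    then show ?thesis unfolding g_def by blast
  qed
  then obtain M where M: "\<And>S. S \<ge> 0 \<Longrightarrow> (a + S) powr p * exp (- d * S) \<le> M" by blast
  define C where "C = exp (pi * \<bar>Im s\<bar>) * (Re x powr p * 1 + \<bar>M\<bar>)"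
  have "C > 0" unfolding C_def using x by (intro mult_pos_pos add_pos_nonneg) auto
  moreover have "norm (1 / (x + of_real S) powr s) \<le> C * exp (d * S)" if "S \<ge> 0" for S
  proof -
    have "h S \<le> C"
      unfolding C_def
      by (rule order_trans[OF hbound[OF that]], intro mult_left_mono add_mono)
         (use M[OF that] in auto)
    then show ?thesis by (simp add: h_def exp_minus field_simps)
  qed
  ultimately show ?thesis using that by blast
qed

lemma euler_ql_term_abs_summable:
  assumes q: "norm (exp L) < 1" and w: "\<And>j. j \<in> {1..r} \<Longrightarrow> w j > 0"
    and chi: "dirichlet_character f chi" and x: "Re x > 0"
  shows "(\<lambda>m. norm (euler_ql_term L chi r w s x m)) summable_on
           (\<Pi>\<^sub>E j\<in>{1..r}. (UNIV :: nat set))"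
proof -
  define d where "d = - Re L / 2"
  have d: "d > 0" using q by (simp add: d_def)
  obtain B where B: "B > 0" "\<And>a. norm (chi a) \<le> B"
    using dirichlet_character_bounded[OF chi] by blast
  obtain C where C: "C > 0"
    "\<And>S. S \<ge> 0 \<Longrightarrow> norm (1 / (x + of_real S) powr s) \<le> C * exp (d * S)"
    using powr_growth_bound[OF x d] by blast
  let ?P = "\<Pi>\<^sub>E j\<in>{1..r}. (UNIV :: nat set)"
  let ?b = "\<lambda>j k::nat. B * exp (- d * w j) ^ k"
  have "Infinite_Sum.abs_summable_on (?b j) UNIV" if "j \<in> {1..r}" for j
    using d w[OF that] B
    by (intro norm_summable_imp_summable_on)
       (auto simp: norm_mult norm_power intro!: summable_mult summable_geometric)
  then have "Infinite_Set_Sum.abs_summable_on (?b j) UNIV" if "j \<in> {1..r}" for j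
    using that abs_summable_equivalent by blast
  then have "Infinite_Set_Sum.abs_summable_on (\<lambda>m. \<Prod>j\<in>{1..r}. ?b j (m j)) ?P"
    by (intro abs_summable_on_prod_PiE) auto
  then have "Infinite_Sum.abs_summable_on (\<lambda>m. \<Prod>j\<in>{1..r}. ?b j (m j)) ?P"
    by (rule abs_summable_equivalent[THEN iffD2])
  then have "(\<lambda>m. \<Prod>j\<in>{1..r}. ?b j (m j)) summable_on ?P"
    by (rule abs_summable_summable)
  then have "(\<lambda>m. C * (\<Prod>j\<in>{1..r}. ?b j (m j))) summable_on ?P"
    by (rule summable_on_cmult_right)
  moreover have "norm (euler_ql_term L chi r w s x m) \<le> C * (\<Prod>j\<in>{1..r}. ?b j (m j))" for m
  proof -
    define S where "S = (\<Sum>j\<in>{1..r}. w j * real (m j))"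
    have S: "S \<ge> 0" unfolding S_def by (intro sum_nonneg mult_nonneg_nonneg) (use w in \<open>auto intro: less_imp_le\<close>)
    have "norm (euler_ql_term L chi r w s x m) =
       (\<Prod>j\<in>{1..r}. norm (chi (int (m j)))) * exp (- 2 * d * S) * norm (1 / (x + of_real S) powr s)"
      by (simp add: euler_ql_term_def S_def norm_mult norm_divide norm_power prod_norm qpow_def
          d_def mult.commute)
    also have "\<dots> \<le> (\<Prod>j\<in>{1..r}. B) * exp (- 2 * d * S) * (C * exp (d * S))"
      using B C(2)[OF S] by (intro mult_mono prod_mono) (auto intro!: prod_nonneg less_imp_le)
    also have "\<dots> = C * ((\<Prod>j\<in>{1..r}. B) * exp (- d * S))"
      by (simp add: mult_exp_exp algebra_simps)
    also have "exp (- d * S) = (\<Prod>j\<in>{1..r}. exp (- d * w j) ^ m j)"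
      by (simp add: S_def sum_distrib_left exp_sum exp_of_nat_mult [symmetric] sum_negf [symmetric]
          algebra_simps del: sum_negf)
    finally show ?thesis by (simp add: prod.distrib)
  qed
  ultimately show ?thesis
    by (rule summable_on_comparison_test) auto
qed

end

theory Submission
  imports Defs
begin

text \<open>For \<open>t\<close> near \<open>0\<close> each factor of the generating function is a geometric series in disguise:
  since \<open>f\<close> is odd, \<open>\<chi>(b) (-1)\<^sup>b\<close> changes sign under \<open>b \<mapsto> b + f\<close>. Multiplying out gives an
  absolutely convergent sum of exponentials \<open>2\<^sup>r \<Sum>\<^sub>m c\<^sub>m exp ((x + \<Sum>\<^sub>j w\<^sub>j m\<^sub>j) t)\<close>, and expanding the
  exponentials and exchanging the two sums identifies the Taylor coefficients with the values of
  the \<open>l\<close>-function at the nonpositive integers.\<close>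

lemma abs_summable_on_bounded_power:
  fixes a :: "nat \<Rightarrow> complex"
  assumes "\<And>m. norm (a m) \<le> B" and y: "norm y < 1"
  shows "Infinite_Sum.abs_summable_on (\<lambda>m. a m * y ^ m) UNIV"
proof (rule Infinite_Sum.abs_summable_on_comparison_test')
  show "(\<lambda>m. B * norm y ^ m) summable_on UNIV"
    by (intro summable_on_cmult_right norm_summable_imp_summable_on)
       (use y in \<open>auto simp: norm_power intro: summable_geometric\<close>)
  show "norm (a m * y ^ m) \<le> B * norm y ^ m" for m
    using assms(1) by (auto simp: norm_mult norm_power intro!: mult_right_mono)
qed

text \<open>Dropping the first \<open>f\<close> terms multiplies the series by \<open>y ^ f\<close>,
  because \<open>a\<close> has period \<open>f\<close>; the resulting linear equation is solved for
  the sum. In the application the sign (-1)^m is absorbed into \<open>y\<close>, so that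
  \<open>a\<close> is the character itself and stays periodic although \<open>f\<close> is
  odd.\<close>

lemma infsum_periodic_power:
  fixes a :: "nat \<Rightarrow> complex"
  assumes bdd: "\<And>m. norm (a m) \<le> B" and per: "\<And>m. a (m + f) = a m"
    and f: "f > 0" and y: "norm y < 1"
  shows "(\<Sum>\<^sub>\<infinity>m. a m * y ^ m) = (\<Sum>b<f. a b * y ^ b) / (1 - y ^ f)"
proof -
  let ?g = "\<lambda>m. a m * y ^ m"
  have sm: "?g summable_on UNIV"
    using abs_summable_on_bounded_power[OF bdd y] by (rule abs_summable_summable)
  then have S: "summable ?g" and inf: "(\<Sum>\<^sub>\<infinity>m. ?g m) = suminf ?g"
    by (auto intro: summable_on_imp_summable sums_unique has_sum_imp_sums has_sum_infsum)
  have "suminf ?g = (\<Sum>m. ?g (m + f)) + (\<Sum>b<f. ?g b)"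
    by (rule suminf_split_initial_segment[OF S])
  also have "(\<Sum>m. ?g (m + f)) = y ^ f * suminf ?g"
    using suminf_mult[OF S, of "y ^ f"] by (simp add: per power_add mult_ac)
  finally have "(1 - y ^ f) * suminf ?g = (\<Sum>b<f. ?g b)" by (simp add: algebra_simps)
  moreover have "norm (y ^ f) < 1"
    using y f by (simp add: norm_power power_less_one_iff)
  then have "1 - y ^ f \<noteq> 0" by auto
  ultimately show ?thesis by (simp add: inf field_simps)
qed

text \<open>Transfers the product theorem from \<open>Infinite_Set_Sum.abs_summable_on\<close> to
  the notion used with \<open>infsum\<close>.\<close>

lemma abs_summable_on_prod_PiE_countable:
  fixes f :: "'a \<Rightarrow> 'b \<Rightarrow> complex"
  assumes "finite A" "\<And>x. x \<in> A \<Longrightarrow> countable (B x)"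
    and "\<And>x. x \<in> A \<Longrightarrow> Infinite_Sum.abs_summable_on (f x) (B x)"
  shows "Infinite_Sum.abs_summable_on (\<lambda>g. \<Prod>x\<in>A. f x (g x)) (PiE A B)"
  using assms
  by (intro abs_summable_equivalent[THEN iffD2] abs_summable_on_prod_PiE)
     (auto simp: abs_summable_equivalent[symmetric])

text \<open>Expand each exponential and apply Fubini. The absolute values of the expansion of
  \<open>exp (z m * t)\<close> sum to exp(|z m * t|), so the hypothesis at the single radius
  \<open>d\<close> dominates the double series for all |t| < d.\<close>

lemma has_fps_expansion_infsum_exp:
  fixes c z :: "'a \<Rightarrow> complex"
  assumes d: "d > 0" and summ: "(\<lambda>m. norm (c m) * exp (d * norm (z m))) summable_on A"
  shows "(\<lambda>t. \<Sum>\<^sub>\<infinity>m\<in>A. c m * exp (z m * t))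
           has_fps_expansion Abs_fps (\<lambda>n. (\<Sum>\<^sub>\<infinity>m\<in>A. c m * z m ^ n) / fact n)"
proof (rule has_fps_expansionI)
  have "(\<lambda>n. fps_nth (Abs_fps (\<lambda>n. (\<Sum>\<^sub>\<infinity>m\<in>A. c m * z m ^ n) / fact n)) n * t ^ n)
          sums (\<Sum>\<^sub>\<infinity>m\<in>A. c m * exp (z m * t))" if t: "norm t < d" for t
  proof -
    let ?F = "\<lambda>(m, n). c m * ((z m * t) ^ n / fact n)"
    \<comment> \<open>Polymorphic in \<open>u\<close>: the real instance sums the norms, the complex
      instance the terms themselves.\<close>
    have exp_sum: "((\<lambda>n. u ^ n / fact n) has_sum exp u) UNIV"
      for u :: "'b :: {real_normed_field, banach}"
      using summable_norm_exp[of u] exp_converges[of u]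
      by (intro norm_summable_imp_has_sum) (auto simp: divide_inverse scaleR_conv_of_real mult_ac)
    have nexp_sum: "((\<lambda>n. norm (?F (m, n))) has_sum norm (c m) * exp (norm (z m * t))) UNIV" for m
      using has_sum_cmult_right[OF exp_sum[of "norm (z m * t)"], of "norm (c m)"]
      by (simp add: norm_mult norm_divide norm_power)
    have "(\<lambda>m. norm (c m) * exp (norm (z m * t))) summable_on A"
      by (rule summable_on_comparison_test[OF summ])
         (use t in \<open>auto simp: norm_mult mult.commute intro!: mult_left_mono mult_right_mono\<close>)
    \<comment> \<open>Tonelli: the inner sums of norms are known from \<open>nexp_sum\<close>, and
      their values are summable over \<open>A\<close>. This justifies the interchange below.\<close>
    then have "Infinite_Sum.abs_summable_on ?F (A \<times> UNIV)"
      by (intro summable_on_SigmaI[OF nexp_sum]) auto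
    then have summF: "?F summable_on A \<times> UNIV" by (rule abs_summable_summable)
    then have "(\<lambda>(n, m). ?F (m, n)) summable_on UNIV \<times> A"
      by (rule summable_on_swap[THEN iffD1])
    then have "(\<lambda>n. \<Sum>\<^sub>\<infinity>m\<in>A. ?F (m, n)) summable_on UNIV"
      by (rule summable_on_Sigma_banach)
    then have "((\<lambda>n. \<Sum>\<^sub>\<infinity>m\<in>A. ?F (m, n)) has_sum (\<Sum>\<^sub>\<infinity>n. \<Sum>\<^sub>\<infinity>m\<in>A. ?F (m, n))) UNIV"
      by (rule has_sum_infsum)
    also have "(\<Sum>\<^sub>\<infinity>n. \<Sum>\<^sub>\<infinity>m\<in>A. ?F (m, n)) = (\<Sum>\<^sub>\<infinity>m\<in>A. \<Sum>\<^sub>\<infinity>n. ?F (m, n))"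
      using infsum_swap_banach[of "\<lambda>m n. ?F (m, n)" A UNIV] summF by simp
    also have "(\<Sum>\<^sub>\<infinity>m\<in>A. \<Sum>\<^sub>\<infinity>n. ?F (m, n)) = (\<Sum>\<^sub>\<infinity>m\<in>A. c m * exp (z m * t))"
      by (intro infsum_cong) (auto intro!: infsumI has_sum_cmult_right exp_sum
            simp del: times_divide_eq_right)
    also have "(\<lambda>n. \<Sum>\<^sub>\<infinity>m\<in>A. ?F (m, n)) = (\<lambda>n. (\<Sum>\<^sub>\<infinity>m\<in>A. c m * z m ^ n) / fact n * t ^ n)"
    proof
      fix n
      show "(\<Sum>\<^sub>\<infinity>m\<in>A. ?F (m, n)) = (\<Sum>\<^sub>\<infinity>m\<in>A. c m * z m ^ n) / fact n * t ^ n"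
        using infsum_cmult_left'[of "\<lambda>m. c m * z m ^ n" "t ^ n / fact n" A]
        by (simp add: power_mult_distrib mult_ac)
    qed
    finally show ?thesis by (simp add: has_sum_imp_sums)
  qed
  then show "eventually (\<lambda>t. (\<lambda>n. fps_nth (Abs_fps (\<lambda>n. (\<Sum>\<^sub>\<infinity>m\<in>A. c m * z m ^ n) / fact n)) n * t ^ n)
          sums (\<Sum>\<^sub>\<infinity>m\<in>A. c m * exp (z m * t))) (nhds 0)"
    unfolding eventually_nhds_metric using d by (intro exI[of _ d]) (auto simp: dist_norm)
qed

text \<open>Separates the variables: in each coordinate the sign, the power of q and the exponential
  merge into one \<open>m j\<close>-th power, so the multiple series becomes a product of
  one-variable power series. For infinite \<open>A\<close> all sums and products take their default
  values and both sides are 1.\<close>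

lemma character_exp_prod:
  fixes chi :: "int \<Rightarrow> complex" and L t :: complex and w :: "nat \<Rightarrow> real" and m :: "nat \<Rightarrow> nat"
  shows "(\<Prod>j\<in>A. chi (int (m j))) * (-1) ^ (\<Sum>j\<in>A. m j) * qpow L (\<Sum>j\<in>A. real (m j) * w j)
           * exp (of_real (\<Sum>j\<in>A. w j * real (m j)) * t)
         = (\<Prod>j\<in>A. chi (int (m j)) * (- exp (of_real (w j) * (L + t))) ^ m j)"
proof (induction A rule: infinite_finite_induct)
  case (insert j A)
  have "(- exp (of_real (w j) * (L + t))) ^ m j
          = (-1) ^ m j * (qpow L (real (m j) * w j) * exp (of_real (w j * real (m j)) * t))"
    by (simp add: power_minus[of "exp _"] qpow_def exp_of_nat_mult[symmetric] mult_exp_exp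
        algebra_simps)
  with insert show ?case
    by (simp add: insert.IH[symmetric] power_add qpow_def exp_add ring_distribs mult_ac)
qed (auto simp: qpow_def)

theorem theorem8:
  fixes r f n :: nat and w :: "nat \<Rightarrow> real" and q L x :: complex and chi :: "int \<Rightarrow> complex"
  assumes "r \<ge> 1"
    and "\<And>j. j \<in> {1..r} \<Longrightarrow> w j > 0"
    and "0 < norm q" and "norm q < 1"
    and "exp L = q"
    and "dirichlet_character_of_conductor f chi"
    and "f mod 2 = 1"
    and "Re x > 0"
  shows "euler_ql L chi r w (- of_nat n) x = barnes_euler L f chi r w n x"
proof -
  note w = assms(2) and x = assms(8)
  let ?P = "\<Pi>\<^sub>E j\<in>{1..r}. (UNIV :: nat set)"
  have chi: "dirichlet_character f chi"
    using assms(6) by (simp add: dirichlet_character_of_conductor_def)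
  then have f: "f > 0" and per: "chi (int (m + f)) = chi (int m)" for m
    by (auto simp: dirichlet_character_def)
  have odd: "odd f" using assms(7) by presburger
  have q: "norm (exp L) < 1" using assms(4,5) by simp
  \<comment> \<open>Half of the distance from Re L to 0: for |t| \<le> d, |exp(L + t)| is at most
    exp(Re L + d) = exp(Re L / 2) < 1. The closed disc is needed because t = d itself serves as the
    dominating point later.\<close>
  define d where "d = - Re L / 2"
  have d: "d > 0" and Ld: "Re L + d < 0" using q by (auto simp: d_def)
  obtain B where B: "\<And>a. norm (chi a) \<le> B"
    using dirichlet_character_bounded[OF chi] by metis

  define c where "c m = (\<Prod>j\<in>{1..r}. chi (int (m j))) * (-1) ^ (\<Sum>j\<in>{1..r}. m j)
       * qpow L (\<Sum>j\<in>{1..r}. real (m j) * w j)" for m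
  define S where "S m = (\<Sum>j\<in>{1..r}. w j * real (m j))" for m
  \<comment> \<open>The contribution of coordinate \<open>j\<close> to the term
    \<open>c m * exp (S m * t)\<close>.\<close>
  define g where "g t j k = chi (int k) * (- exp (of_real (w j) * (L + t))) ^ k" for t j and k :: nat
  have c_exp: "c m * exp (of_real (S m) * t) = (\<Prod>j\<in>{1..r}. g t j (m j))" for m t
    unfolding c_def S_def g_def by (rule character_exp_prod)
  have S_nonneg: "S m \<ge> 0" for m
    unfolding S_def by (intro sum_nonneg mult_nonneg_nonneg) (use w in \<open>auto intro: less_imp_le\<close>)

  have small: "norm (- exp (of_real (w j) * (L + t))) < 1" if "j \<in> {1..r}" "norm t \<le> d" for j t
    using w[OF that(1)] Ld complex_Re_le_cmod[of t] that(2) by (simp add: mult_pos_neg)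
  have g_summ: "Infinite_Sum.abs_summable_on (g t j) UNIV" if "j \<in> {1..r}" "norm t \<le> d" for j t
    unfolding g_def by (rule abs_summable_on_bounded_power[where a = "\<lambda>k. chi (int k)", OF B small[OF that]])
  have g_sum: "2 * infsum (g t j) UNIV =
      (2 * (\<Sum>b<f. chi (int b) * qpow L (w j * real b) * (-1) ^ b
                      * exp (of_real (w j * real b) * t)))
        / (qpow L (w j * real f) * exp (of_real (w j * real f) * t) + 1)"
    if "j \<in> {1..r}" "norm t \<le> d" for j t
  proof -
    let ?y = "exp (of_real (w j) * (L + t))"
    have y: "?y ^ b = qpow L (w j * real b) * exp (of_real (w j * real b) * t)" for b
      by (simp add: qpow_def exp_of_nat_mult[symmetric] mult_exp_exp algebra_simps)
    have "infsum (g t j) UNIV = (\<Sum>b<f. chi (int b) * (- ?y) ^ b) / (1 - (- ?y) ^ f)"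
      unfolding g_def by (rule infsum_periodic_power[where a = "\<lambda>k. chi (int k)", OF B per f small[OF that]])
    \<comment> \<open>Here oddness of \<open>f\<close> produces the plus sign in the denominator of
      the generating function.\<close>
    also have "1 - (- ?y) ^ f = qpow L (w j * real f) * exp (of_real (w j * real f) * t) + 1"
      using odd by (simp add: power_minus_odd y)
    also have "(\<Sum>b<f. chi (int b) * (- ?y) ^ b) = (\<Sum>b<f. chi (int b) * qpow L (w j * real b) * (-1) ^ b
                      * exp (of_real (w j * real b) * t))"
      by (intro sum.cong refl) (subst power_minus, simp only: y, simp)
    finally show ?thesis by simp
  qed
  have gf: "barnes_euler_gf L f chi r w x t
              = (\<Sum>\<^sub>\<infinity>m\<in>?P. (2 ^ r * c m) * exp ((x + of_real (S m)) * t))"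
    if t: "norm t < d" for t
  proof -
    have "barnes_euler_gf L f chi r w x t = exp (x * t) * (\<Prod>j\<in>{1..r}. 2 * infsum (g t j) UNIV)"
      unfolding barnes_euler_gf_def using g_sum t by simp
    also have "\<dots> = (2 ^ r * exp (x * t)) * (\<Prod>j\<in>{1..r}. infsum (g t j) UNIV)"
      by (simp add: prod.distrib)
    \<comment> \<open>A finite product of absolutely convergent series is the series over all index
      tuples.\<close>
    also have "(\<Prod>j\<in>{1..r}. infsum (g t j) UNIV) = (\<Sum>\<^sub>\<infinity>m\<in>?P. \<Prod>j\<in>{1..r}. g t j (m j))"
      using g_summ t by (intro infsum_prod_PiE_abs[symmetric]) auto
    also have "(2 ^ r * exp (x * t)) * \<dots>
        = (\<Sum>\<^sub>\<infinity>m\<in>?P. (2 ^ r * exp (x * t)) * (\<Prod>j\<in>{1..r}. g t j (m j)))"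
      by (rule infsum_cmult_right'[symmetric])
    finally show ?thesis
      by (simp add: c_exp[symmetric] exp_add ring_distribs mult_ac del: One_nat_def)
  qed

  \<comment> \<open>At the real point t = d the factor exp(d * S m) is positive, so the norm of the
    product is exactly |c m| exp(d * S m). With |x + S m| \<le> |x| + S m this yields the domination
    required for the expansion.\<close>
  have "(\<lambda>m. norm (\<Prod>j\<in>{1..r}. g (of_real d) j (m j))) summable_on ?P"
    using g_summ d by (intro abs_summable_on_prod_PiE_countable) auto
  then have "(\<lambda>m. (2 ^ r * exp (d * norm x)) * norm (\<Prod>j\<in>{1..r}. g (of_real d) j (m j))) summable_on ?P"
    by (rule summable_on_cmult_right)
  then have "(\<lambda>m. norm (2 ^ r * c m) * exp (d * norm (x + of_real (S m)))) summable_on ?P"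
  proof (rule summable_on_comparison_test)
    fix m
    have "norm (x + of_real (S m)) \<le> norm x + S m"
      using norm_triangle_ineq[of x "of_real (S m)"] S_nonneg[of m] by simp
    then have "exp (d * norm (x + of_real (S m))) \<le> exp (d * norm x) * exp (S m * d)"
      using d by (simp add: mult_exp_exp distrib_left[symmetric] mult.commute[of "S m"])
    then have "norm (c m) * exp (d * norm (x + of_real (S m)))
                 \<le> norm (c m) * (exp (d * norm x) * exp (S m * d))"
      by (rule mult_left_mono) simp
    also have "\<dots> = exp (d * norm x) * norm (\<Prod>j\<in>{1..r}. g (of_real d) j (m j))"
      by (simp add: c_exp[symmetric] norm_mult del: One_nat_def)
    finally show "norm (2 ^ r * c m) * exp (d * norm (x + of_real (S m)))
        \<le> (2 ^ r * exp (d * norm x)) * norm (\<Prod>j\<in>{1..r}. g (of_real d) j (m j))"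
      by (simp add: norm_mult norm_power)
  qed auto
  from has_fps_expansion_infsum_exp[OF d this]
  \<comment> \<open>The identity \<open>gf\<close> is available only for |t| < d, which suffices
    since the expansion depends only on the germ at 0.\<close>
  have "barnes_euler_gf L f chi r w x has_fps_expansion
          Abs_fps (\<lambda>n. (\<Sum>\<^sub>\<infinity>m\<in>?P. (2 ^ r * c m) * (x + of_real (S m)) ^ n) / fact n)"
    by (rule has_fps_expansion_cong[THEN iffD2, rotated 2])
       (use gf d in \<open>auto simp: eventually_nhds_metric dist_norm\<close>)
  then have "Abs_fps (\<lambda>n. (\<Sum>\<^sub>\<infinity>m\<in>?P. (2 ^ r * c m) * (x + of_real (S m)) ^ n) / fact n)
               = Abs_fps (\<lambda>n. barnes_euler L f chi r w n x / fact n)"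
    using barnes_euler_has_fps_expansion[OF q w f] by (rule fps_expansion_unique_complex)
  then have "barnes_euler L f chi r w n x = (\<Sum>\<^sub>\<infinity>m\<in>?P. 2 ^ r * (c m * (x + of_real (S m)) ^ n))"
    by (simp add: fps_eq_iff mult.assoc)
  also have "\<dots> = 2 ^ r * (\<Sum>\<^sub>\<infinity>m\<in>?P. c m * (x + of_real (S m)) ^ n)"
    by (rule infsum_cmult_right')
  also have "\<dots> = euler_ql L chi r w (- of_nat n) x"
  proof -
    have "euler_ql_term L chi r w (- of_nat n) x m = c m * (x + of_real (S m)) ^ n" for m
    proof -
      \<comment> \<open>Needed to turn \<open>powr\<close> into an ordinary power also for n = 0,
        since \<open>0 powr 0\<close> is 0 while \<open>0 ^ 0\<close> is 1.\<close>
      have "x + of_real (S m) \<noteq> 0"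
        using x S_nonneg[of m] by (auto simp: complex_eq_iff)
      then show ?thesis
        unfolding euler_ql_term_def c_def[symmetric] S_def[symmetric]
        by (simp add: powr_minus powr_nat' divide_inverse)
    qed
    then show ?thesis by (simp add: euler_ql_def)
  qed
  finally show ?thesis ..
qed

end
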